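(* Let $\Omega\subset\mathbb{C}$ be a simply connected domain and let $f=h\overline{g}$ be a sense-preserving logharmonic mapping in $\Omega$, where $h$ and $g$ are non-vanishing. Let $\varphi$ be a locally univalent analytic function for which the composition $f\circ\varphi$ is defined (i.e. $\varphi$ is analytic with non-vanishing derivative on a domain and takes values in $\Omega$). Then $$P_{f\circ\varphi}=(P_f\circ\varphi)\,\varphi'+P\varphi .$$
   Context: A sense-preserving (locally univalent) logharmonic mapping $f=h\overline{g}$ on a domain: $h,g$ are analytic there, $h'$ does not vanish, $g$ does not vanish, and the (second complex) dilatation $\omega=\dfrac{g'h}{gh'}$ satisfies $|\omega|<1$ everywhere. Its Jacobian is $J_f=|f_z|^2-|f_{\overline z}|^2=|h'g|^2(1-|\omega|^2)>0$. Its pre-Schwarzian derivative is $$P_f=\frac{h''}{h'}+\omega\frac{h'}{h}-\frac{\omega'\overline{\omega}}{1-|\omega|^2},$$ where $\omega\, h'/h=g'/g$. For a locally univalent analytic function $\varphi$, $P\varphi=\varphi''/\varphi'$. If $f=h\overline g$ is a sense-preserving logharmonic mapping in a simply connected domain $\Omega\subset\mathbb{C}$ with $h$ and $g$ analytic and non-vanishing, $h'$ non-vanishing, and dilatation $\omega=\dfrac{g'h}{gh'}$ satisfying $|\omega|<1$ in $\Omega$, and $\varphi$ is a locally univalent analytic function on a domain with values in $\Omega$, then $f\circ\varphi=(h\circ\varphi)\overline{(g\circ\varphi)}$ is again a sense-preserving logharmonic mapping on the domain of $\varphi$, with analytic factors $h\circ\varphi$, $g\circ\varphi$ and dilatation $\omega\circ\varphi$.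 *)

theory Defs
  imports "HOL-Analysis.Analysis"
begin

definition domain :: "complex set \<Rightarrow> bool" where
  "domain S \<longleftrightarrow> open S \<and> connected S \<and> S \<noteq> {}"

definition dilatation :: "(complex \<Rightarrow> complex) \<Rightarrow> (complex \<Rightarrow> complex) \<Rightarrow> complex \<Rightarrow> complex" where
  "dilatation h g z = (deriv g z * h z) / (g z * deriv h z)"

text \<open>The factors of a logharmonic mapping are determined by the mapping only up to
  constants, so they are kept as explicit arguments. The factor \<open>h\<close> may have zeros.\<close>

definition sense_preserving_logharmonic_on ::
    "complex set \<Rightarrow> (complex \<Rightarrow> complex) \<Rightarrow> (complex \<Rightarrow> complex) \<Rightarrow> (complex \<Rightarrow> complex) \<Rightarrow> bool" where
  "sense_preserving_logharmonic_on S f h g \<longleftrightarrow>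
     domain S \<and>
     (\<forall>z\<in>S. f z = h z * cnj (g z)) \<and>
     h holomorphic_on S \<and> g holomorphic_on S \<and>
     (\<forall>z\<in>S. deriv h z \<noteq> 0) \<and> (\<forall>z\<in>S. g z \<noteq> 0) \<and>
     (\<forall>z\<in>S. cmod (dilatation h g z) < 1)"

text \<open>The pre-Schwarzian derivative of \<open>f = h * cnj g\<close>. It is meant for points with
  \<open>h z \<noteq> 0\<close>: at a zero of \<open>h\<close>, the second term should be read as \<open>g' / g\<close>, whereas
  division by zero makes it \<open>0\<close> here.\<close>

definition logharmonic_pre_schwarzian ::
    "(complex \<Rightarrow> complex) \<Rightarrow> (complex \<Rightarrow> complex) \<Rightarrow> complex \<Rightarrow> complex" where
  "logharmonic_pre_schwarzian h g z =
     deriv (deriv h) z / deriv h z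
     + dilatation h g z * (deriv h z / h z)
     - deriv (dilatation h g) z * cnj (dilatation h g z)
         / (1 - of_real ((cmod (dilatation h g z))\<^sup>2))"

definition pre_schwarzian :: "(complex \<Rightarrow> complex) \<Rightarrow> complex \<Rightarrow> complex" where
  "pre_schwarzian \<phi> z = deriv (deriv \<phi>) z / deriv \<phi> z"

end

theory Submission
  imports Defs "HOL-Complex_Analysis.Complex_Analysis"
begin

text \<open>The chain rule gives the formula for the factors \<open>h \<circ> \<phi>\<close> and \<open>g \<circ> \<phi>\<close>. Any two
  factorizations \<open>H * cnj G = h * cnj g\<close> without zeros satisfy \<open>H / h = cnj (g / G)\<close>, which is
  both holomorphic and antiholomorphic, hence a constant \<open>c\<close>. Scaling the factors to
  \<open>c * h\<close> and \<open>g / cnj c\<close> changes neither the dilatation nor the pre-Schwarzian derivative.\<close>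

text \<open>Identities between the functions here are known only on the domain, so openness is what
  allows them to be differentiated.\<close>

lemma deriv_cong_open:
  assumes "open S" "z \<in> S" "\<And>w. w \<in> S \<Longrightarrow> f w = g w"
  shows "deriv f z = deriv g z"
  using assms by (intro deriv_cong_ev) (auto simp: eventually_nhds)

lemma deriv_comp_holomorphic:
  assumes "open S" "open T" "\<phi> holomorphic_on S" "f holomorphic_on T" "\<phi> ` S \<subseteq> T" "z \<in> S"
  shows "deriv (f \<circ> \<phi>) z = deriv f (\<phi> z) * deriv \<phi> z"
  using assms by (intro deriv_chain) (auto simp: holomorphic_on_imp_differentiable_at)

text \<open>As the derivative of \<open>u\<close>, the real-linear map at \<open>z\<close> is
  complex linear; as the derivative of the conjugate of \<open>v\<close>, it is conjugate linear.
  Derivatives are unique, and only the zero map is both.\<close>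

lemma deriv_eq_0_if_eq_cnj_holomorphic:
  assumes "open S" "u holomorphic_on S" "v holomorphic_on S"
    and eq: "\<And>z. z \<in> S \<Longrightarrow> u z = cnj (v z)" and "z \<in> S"
  shows "(u has_field_derivative 0) (at z)"
proof -
  obtain a where a: "(u has_field_derivative a) (at z)"
    using assms by (meson holomorphic_derivI)
  obtain b where b: "(v has_field_derivative b) (at z)"
    using assms by (meson holomorphic_derivI)
  have "((\<lambda>w. cnj (v w)) has_derivative (\<lambda>t. cnj (b * t))) (at z)"
    using b unfolding has_field_derivative_def
    by (rule bounded_linear.has_derivative[OF bounded_linear_cnj])
  then have "(u has_derivative (\<lambda>t. cnj (b * t))) (at z)"
    by (rule has_derivative_transform_within_open[OF _ \<open>open S\<close> \<open>z \<in> S\<close>]) (simp add: eq)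
  then have "(\<lambda>t. cnj (b * t)) = (*) a"
    using a unfolding has_field_derivative_def by (rule has_derivative_unique)
  \<comment> \<open>The value at 1 gives \<open>cnj b = a\<close>; the value at the imaginary unit
    then gives \<open>- \<i> * a = a * \<i>\<close>, which forces \<open>a = 0\<close>.\<close>
  from fun_cong[OF this, of 1] fun_cong[OF this, of \<i>]
  have "cnj b = a" "cnj (b * \<i>) = a * \<i>"
    by simp_all
  then have "a = 0"
    by (auto simp: algebra_simps)
  then show ?thesis
    using a by simp
qed

lemma constant_if_eq_cnj_holomorphic:
  assumes "open S" "connected S" "u holomorphic_on S" "v holomorphic_on S"
    and "\<And>z. z \<in> S \<Longrightarrow> u z = cnj (v z)"
  obtains c where "\<And>z. z \<in> S \<Longrightarrow> u z = c"
proof -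
  have "(u has_field_derivative 0) (at z)" if "z \<in> S" for z
    using deriv_eq_0_if_eq_cnj_holomorphic[OF assms(1,3-5) that] .
  moreover have "continuous_on S u"
    using assms(3) by (rule holomorphic_on_imp_continuous_on)
  \<comment> \<open>The cited fact tolerates a finite exceptional set, taken here to be
    empty.\<close>
  ultimately show ?thesis
    using DERIV_zero_connected_constant[OF assms(2,1) finite.emptyI, of u] that by auto
qed

lemma factors_unique_up_to_constant:
  assumes "open S" "connected S"
    and hol: "h holomorphic_on S" "g holomorphic_on S" "H holomorphic_on S" "G holomorphic_on S"
    and nz: "\<And>z. z \<in> S \<Longrightarrow> h z \<noteq> 0" "\<And>z. z \<in> S \<Longrightarrow> g z \<noteq> 0" "\<And>z. z \<in> S \<Longrightarrow> G z \<noteq> 0"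
    and eq: "\<And>z. z \<in> S \<Longrightarrow> H z * cnj (G z) = h z * cnj (g z)"
  obtains c where "c \<noteq> 0" "\<And>z. z \<in> S \<Longrightarrow> H z = c * h z" "\<And>z. z \<in> S \<Longrightarrow> G z = g z / cnj c"
proof (cases "S = {}")
  case True
  \<comment> \<open>Without a point of \<open>S\<close> nothing excludes \<open>c = 0\<close>, so
    any non-zero witness is given. Otherwise \<open>cnj c\<close> is a quotient of non-zero values
    of \<open>g\<close> and \<open>G\<close>.\<close>
  then show ?thesis using that[of 1] by simp
next
  case False
  have quot: "H z / h z = cnj (g z / G z)" if "z \<in> S" for z
    using eq[OF that] nz that by (simp add: field_simps)
  obtain c where c: "\<And>z. z \<in> S \<Longrightarrow> H z / h z = c"
  proof (rule constant_if_eq_cnj_holomorphic[OF assms(1,2)])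
    show "(\<lambda>z. H z / h z) holomorphic_on S" "(\<lambda>z. g z / G z) holomorphic_on S"
      using hol nz by (auto intro!: holomorphic_intros)
  qed (use quot in auto)
  have c': "g z / G z = cnj c" if "z \<in> S" for z
    using quot[OF that] c[OF that] by (metis complex_cnj_cnj)
  show ?thesis
  proof
    show "c \<noteq> 0"
      using False c' nz by fastforce
    then show "G z = g z / cnj c" if "z \<in> S" for z
      using c'[OF that] nz(3)[OF that] by (auto simp: field_simps)
    show "H z = c * h z" if "z \<in> S" for z
      using c[OF that] nz(1)[OF that] by (auto simp: field_simps)
  qed
qed

lemma dilatation_holomorphic_on:
  assumes "open S" "h holomorphic_on S" "g holomorphic_on S"
    and "\<And>z. z \<in> S \<Longrightarrow> deriv h z \<noteq> 0" "\<And>z. z \<in> S \<Longrightarrow> g z \<noteq> 0"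
  shows "dilatation h g holomorphic_on S"
  unfolding dilatation_def using assms by (auto intro!: holomorphic_intros)

text \<open>Every term is built from quotients in which \<open>c\<close> and \<open>d\<close>
  cancel. With \<open>x / 0 = 0\<close> this cancellation also holds at zeros of the denominators.
  The scaling is assumed on all of the open set because it gets differentiated, twice for
  \<open>H\<close>.\<close>

lemma logharmonic_pre_schwarzian_rescale:
  assumes "open S" "h holomorphic_on S" "g holomorphic_on S" "c \<noteq> 0" "d \<noteq> 0"
    and H: "\<And>z. z \<in> S \<Longrightarrow> H z = c * h z" and G: "\<And>z. z \<in> S \<Longrightarrow> G z = d * g z"
    and "z \<in> S"
  shows "logharmonic_pre_schwarzian H G z = logharmonic_pre_schwarzian h g z"
proof -
  have dH: "deriv H w = c * deriv h w" if "w \<in> S" for w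
    using deriv_cong_open[OF \<open>open S\<close> that H] assms(1,2) that
    by (simp add: deriv_cmult holomorphic_on_imp_differentiable_at)
  have dG: "deriv G w = d * deriv g w" if "w \<in> S" for w
    using deriv_cong_open[OF \<open>open S\<close> that G] assms(1,3) that
    by (simp add: deriv_cmult holomorphic_on_imp_differentiable_at)
  have ddH: "deriv (deriv H) z = c * deriv (deriv h) z"
    using deriv_cong_open[OF \<open>open S\<close> \<open>z \<in> S\<close> dH] holomorphic_deriv[OF assms(2,1)] \<open>z \<in> S\<close> \<open>open S\<close>
    by (simp add: deriv_cmult holomorphic_on_imp_differentiable_at)
  have dil: "dilatation H G w = dilatation h g w" if "w \<in> S" for w
    using that assms(4,5) by (simp add: dilatation_def H G dH dG)
  show ?thesis
    using assms(4) \<open>z \<in> S\<close> deriv_cong_open[OF \<open>open S\<close> \<open>z \<in> S\<close> dil]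
    by (simp add: logharmonic_pre_schwarzian_def dil ddH dH H)
qed

text \<open>By the chain rule \<open>deriv \<phi> z\<close> enters numerator and denominator once
  each and cancels.\<close>

lemma dilatation_comp:
  assumes "open S" "open T" "\<phi> holomorphic_on S" "\<phi> ` S \<subseteq> T"
    and "h holomorphic_on T" "g holomorphic_on T" "z \<in> S" "deriv \<phi> z \<noteq> 0"
  shows "dilatation (h \<circ> \<phi>) (g \<circ> \<phi>) z = dilatation h g (\<phi> z)"
  using assms deriv_comp_holomorphic[OF assms(1-3,5,4,7)]
    deriv_comp_holomorphic[OF assms(1-3,6,4,7)]
  by (simp add: dilatation_def)

text \<open>Each of the three terms picks up one factor \<open>deriv \<phi> z\<close>. Only the
  first yields more: differentiating the product \<open>(h' \<circ> \<phi>) * \<phi>'\<close> also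
  hits the second factor, which produces \<open>pre_schwarzian \<phi> z\<close>. At a zero of
  \<open>h \<circ> \<phi>\<close> the middle term is 0 on both sides.\<close>

lemma logharmonic_pre_schwarzian_comp:
  assumes S: "open S" and T: "open T" and \<phi>: "\<phi> holomorphic_on S" "\<phi> ` S \<subseteq> T"
    and d\<phi>: "\<And>z. z \<in> S \<Longrightarrow> deriv \<phi> z \<noteq> 0"
    and h: "h holomorphic_on T" and g: "g holomorphic_on T"
    and nz: "\<And>w. w \<in> T \<Longrightarrow> deriv h w \<noteq> 0" "\<And>w. w \<in> T \<Longrightarrow> g w \<noteq> 0"
    and z: "z \<in> S"
  shows "logharmonic_pre_schwarzian (h \<circ> \<phi>) (g \<circ> \<phi>) z =
    logharmonic_pre_schwarzian h g (\<phi> z) * deriv \<phi> z + pre_schwarzian \<phi> z"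
proof -
  note chain = deriv_comp_holomorphic[OF S T \<phi>(1) _ \<phi>(2)]
  have dh: "deriv (h \<circ> \<phi>) w = (deriv h \<circ> \<phi>) w * deriv \<phi> w" if "w \<in> S" for w
    using chain[OF h that] by simp
  have h': "deriv h holomorphic_on T" and \<phi>': "deriv \<phi> holomorphic_on S"
    using h T \<phi>(1) S by (auto intro: holomorphic_deriv)
  have "(deriv h \<circ> \<phi>) field_differentiable at z"
    using holomorphic_on_imp_differentiable_at[OF
        holomorphic_on_compose_gen[OF \<phi>(1) h' \<phi>(2)] S z] .
  moreover have "deriv \<phi> field_differentiable at z"
    using holomorphic_on_imp_differentiable_at[OF \<phi>' S z] .
  ultimately have "deriv (\<lambda>w. (deriv h \<circ> \<phi>) w * deriv \<phi> w) z =
      (deriv h \<circ> \<phi>) z * deriv (deriv \<phi>) z + deriv (deriv h \<circ> \<phi>) z * deriv \<phi> z"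
    by (rule deriv_mult)
  moreover have "deriv (deriv (h \<circ> \<phi>)) z = deriv (\<lambda>w. (deriv h \<circ> \<phi>) w * deriv \<phi> w) z"
    using S z dh by (rule deriv_cong_open)
  ultimately have ddh: "deriv (deriv (h \<circ> \<phi>)) z =
      deriv h (\<phi> z) * deriv (deriv \<phi>) z + deriv (deriv h) (\<phi> z) * (deriv \<phi> z)\<^sup>2"
    using chain[OF h' z] by (simp add: power2_eq_square)
  \<comment> \<open>Stated on all of \<open>S\<close>, not just at \<open>z\<close>, so that it can
    be differentiated for \<open>ddil\<close>.\<close>
  have dil: "dilatation (h \<circ> \<phi>) (g \<circ> \<phi>) w = (dilatation h g \<circ> \<phi>) w" if "w \<in> S" for w
    using dilatation_comp[OF S T \<phi> h g that d\<phi>[OF that]] by simp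
  have ddil: "deriv (dilatation (h \<circ> \<phi>) (g \<circ> \<phi>)) z = deriv (dilatation h g) (\<phi> z) * deriv \<phi> z"
    using trans[OF deriv_cong_open[OF S z dil] chain[OF dilatation_holomorphic_on[OF T h g nz] z]] .
  \<comment> \<open>Both are needed to split the quotient: \<open>deriv h (\<phi> z)\<close> cancels
    in one summand of \<open>ddh\<close>, and a factor \<open>deriv \<phi> z\<close> in the
    other.\<close>
  have "deriv h (\<phi> z) \<noteq> 0" "deriv \<phi> z \<noteq> 0"
    using nz(1) d\<phi> \<phi>(2) z by auto
  then have "deriv (deriv (h \<circ> \<phi>)) z / deriv (h \<circ> \<phi>) z =
      deriv (deriv h) (\<phi> z) / deriv h (\<phi> z) * deriv \<phi> z + pre_schwarzian \<phi> z"
    unfolding ddh dh[OF z] pre_schwarzian_def by (simp add: field_simps power2_eq_square)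
  then show ?thesis
    by (simp add: logharmonic_pre_schwarzian_def ddil dil[OF z] dh[OF z] algebra_simps)
qed

lemma sense_preserving_logharmonic_on_comp:
  assumes f: "sense_preserving_logharmonic_on T f h g" and S: "domain S"
    and \<phi>: "\<phi> holomorphic_on S" "\<And>z. z \<in> S \<Longrightarrow> deriv \<phi> z \<noteq> 0" "\<phi> ` S \<subseteq> T"
  shows "sense_preserving_logharmonic_on S (f \<circ> \<phi>) (h \<circ> \<phi>) (g \<circ> \<phi>)"
proof -
  have ST: "open S" "open T" and h: "h holomorphic_on T" and g: "g holomorphic_on T"
    using f S by (auto simp: sense_preserving_logharmonic_on_def domain_def)
  show ?thesis
    unfolding sense_preserving_logharmonic_on_def
  proof (intro conjI ballI)
    show "domain S" "(h \<circ> \<phi>) holomorphic_on S" "(g \<circ> \<phi>) holomorphic_on S"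
      using S \<phi> h g by (auto intro: holomorphic_on_compose_gen)
    fix z assume z: "z \<in> S"
    then have "\<phi> z \<in> T"
      using \<phi>(3) by auto
    then show "(f \<circ> \<phi>) z = (h \<circ> \<phi>) z * cnj ((g \<circ> \<phi>) z)" "(g \<circ> \<phi>) z \<noteq> 0"
        "deriv (h \<circ> \<phi>) z \<noteq> 0" "cmod (dilatation (h \<circ> \<phi>) (g \<circ> \<phi>) z) < 1"
      using f \<phi>(2)[OF z] deriv_comp_holomorphic[OF ST \<phi>(1) h \<phi>(3) z]
        dilatation_comp[OF ST \<phi>(1,3) h g z]
      by (simp_all add: sense_preserving_logharmonic_on_def)
  qed
qed

theorem mainTheorem1:
  fixes \<Omega> D :: "complex set" and f h g \<phi> :: "complex \<Rightarrow> complex"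
  assumes "simply_connected \<Omega>"
    and "sense_preserving_logharmonic_on \<Omega> f h g"
    and "\<forall>w\<in>\<Omega>. h w \<noteq> 0" and "\<forall>w\<in>\<Omega>. g w \<noteq> 0"
    and "domain D"
    and "\<phi> holomorphic_on D" and "\<forall>z\<in>D. deriv \<phi> z \<noteq> 0" and "\<phi> ` D \<subseteq> \<Omega>"
  shows "sense_preserving_logharmonic_on D (f \<circ> \<phi>) (h \<circ> \<phi>) (g \<circ> \<phi>) \<and>
    (\<forall>H G. sense_preserving_logharmonic_on D (f \<circ> \<phi>) H G \<longrightarrow>
      (\<forall>z\<in>D. logharmonic_pre_schwarzian H G z =
         logharmonic_pre_schwarzian h g (\<phi> z) * deriv \<phi> z + pre_schwarzian \<phi> z))"
proof (intro conjI allI impI ballI)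
  show comp: "sense_preserving_logharmonic_on D (f \<circ> \<phi>) (h \<circ> \<phi>) (g \<circ> \<phi>)"
    using assms(7) by (intro sense_preserving_logharmonic_on_comp[OF assms(2,5,6) _ assms(8)]) simp
  \<comment> \<open>The pre-Schwarzian is a function of the factors, so the formula is proved for an
    arbitrary factor pair of \<open>f \<circ> \<phi>\<close>, by comparison with the composed
    pair.\<close>
  fix H G z
  assume HG: "sense_preserving_logharmonic_on D (f \<circ> \<phi>) H G" and z: "z \<in> D"
  have D: "open D" "connected D" and \<Omega>: "open \<Omega>"
    using assms(2,5) by (auto simp: sense_preserving_logharmonic_on_def domain_def)
  have hol: "(h \<circ> \<phi>) holomorphic_on D" "(g \<circ> \<phi>) holomorphic_on D"
      "H holomorphic_on D" "G holomorphic_on D"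
    using comp HG by (auto simp: sense_preserving_logharmonic_on_def)
  obtain c where c: "c \<noteq> 0" "\<And>w. w \<in> D \<Longrightarrow> H w = c * (h \<circ> \<phi>) w"
      "\<And>w. w \<in> D \<Longrightarrow> G w = (g \<circ> \<phi>) w / cnj c"
  proof (rule factors_unique_up_to_constant[OF D hol])
    fix w assume w: "w \<in> D"
    \<comment> \<open>A logharmonic mapping may have zeros in its first factor, so this rests on the
      separate hypothesis that \<open>h\<close> has none on \<open>\<Omega>\<close>.\<close>
    show "(h \<circ> \<phi>) w \<noteq> 0"
      using assms(3,8) w by auto
    show "(g \<circ> \<phi>) w \<noteq> 0" "G w \<noteq> 0"
      using comp HG w unfolding sense_preserving_logharmonic_on_def by blast+
    show "H w * cnj (G w) = (h \<circ> \<phi>) w * cnj ((g \<circ> \<phi>) w)"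
      using comp HG w unfolding sense_preserving_logharmonic_on_def by metis
  qed blast
  have "logharmonic_pre_schwarzian H G z = logharmonic_pre_schwarzian (h \<circ> \<phi>) (g \<circ> \<phi>) z"
    by (rule logharmonic_pre_schwarzian_rescale[OF D(1) hol(1,2) c(1), of "1 / cnj c"])
      (use c z in auto)
  also have "\<dots> = logharmonic_pre_schwarzian h g (\<phi> z) * deriv \<phi> z + pre_schwarzian \<phi> z"
    using assms(2,7)
    by (intro logharmonic_pre_schwarzian_comp[OF D(1) \<Omega> assms(6,8) _ _ _ _ _ z])
      (auto simp: sense_preserving_logharmonic_on_def)
  finally show "logharmonic_pre_schwarzian H G z =
      logharmonic_pre_schwarzian h g (\<phi> z) * deriv \<phi> z + pre_schwarzian \<phi> z" .
qed

end
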